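(* Let $\mathcal F=(V,E,\phi)$ be a framework, let $X_1,\dots,X_r$ be dependent sets of implicit edges, and let $S\subseteq V$ be a subset of vertices such that any two vertices of $S$ are connected through a path of implicit edges all belonging to $\bigcup_i X_i$. If $\mathrm{cl}_{\mathrm{pin}}(S)=V$, then $\dim \mathbb{DC}(\mathcal F)\le r$.
   Context: A framework in $\mathbb R^d$ ($d\ge 1$) is a triple $\mathcal F=(V,E,\phi)$ with $V$ a finite set (vertices), $E\subseteq\binom{V}{2}$ (edges), and $\phi:V\to\mathbb R^d$. A pair $uv$ is degenerate if $\phi_u=\phi_v$, non-degenerate otherwise. A framework $\mathcal G=(V,E,\psi)$ in $\mathbb R^d$ on the same graph is a deformation of $\mathcal F$ if for every $uv\in E$ there is $\lambda_{uv}\ge 0$ with $\psi_v-\psi_u=\lambda_{uv}(\phi_v-\phi_u)$. The edge-deformation vector of $\mathcal G$ is the vector in $\mathbb R_{\ge 0}^E$ with coordinate $\lambda_{uv}$ for non-degenerate $uv\in E$ and $0$ for degenerate $uv\in E$. The deformation cone $\mathbb{DC}(\mathcal F)\subset\mathbb R^E$ is the set of edge-deformation vectors of all deformations of $\mathcal F$ (a polyhedral cone). Implicit edges: a pair $u,v\in V$ is an implicit edge if for every deformation $(V,E,\psi)$ there is $\lambda_{uv}\ge0$ with $\psi_v-\psi_u=\lambda_{uv}(\phi_v-\phi_u)$. Two non-degenerate implicit edges are dependent if their coefficients $\lambda$ coincide for every deformation of $\mathcal F$; a set of (non-degenerate) implicit edges is dependent if its elements are pairwise dependent. Pinning: a flat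 of $\mathcal F$ is a subset $F\subseteq V$ such that any two vertices of $F$ are joined by a path of edges of $\mathcal F$ using only vertices in $F$. Its direction is $\mathrm{dir}(F)=\mathrm{lin}\{\phi_u-\phi_v : u,v\in F\}$. A collection $\mathcal C$ of flats pins a vertex $v$ if there is $\mathcal I\subseteq\mathcal C$ with $v\in\bigcap_{F\in\mathcal I}F$ and $\bigcap_{F\in\mathcal I}\mathrm{dir}(F)=\{0\}$. It is grounded on $S\subseteq V$ if every flat of $\mathcal C$ contains some vertex of $S$. Put $S_0=S$ and $S_i=S_{i-1}\cup\{v\in V: v\text{ is pinned by a collection of flats grounded on }S_{i-1}\}$ for $i\geq1$; the sequence stabilizes, and the pinning closure $\mathrm{cl}_{\mathrm{pin}}(S)$ is the stable set. *)

theory Defs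
  imports "HOL-Analysis.Analysis" "HOL-Library.Function_Algebras"
begin

instantiation "fun" :: (type, real_vector) real_vector
begin

definition scaleR_fun :: "real \<Rightarrow> ('a \<Rightarrow> 'b) \<Rightarrow> 'a \<Rightarrow> 'b"
  where "scaleR_fun c f = (\<lambda>x. c *\<^sub>R f x)"

instance
  by standard (auto simp: scaleR_fun_def fun_eq_iff algebra_simps)

end

text \<open>
  A framework is given by a vertex set \<open>V\<close>, an edge set \<open>E\<close> of two-element subsets of \<open>V\<close> and a
  map \<open>\<phi>\<close>, of which only the values on \<open>V\<close> matter. Unordered pairs of vertices are sets \<open>{u, v}\<close>.
\<close>

definition framework :: "'v set \<Rightarrow> 'v set set \<Rightarrow> ('v \<Rightarrow> real ^ 'd) \<Rightarrow> bool" where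
  "framework V E \<phi> \<longleftrightarrow> finite V \<and> E \<subseteq> {e. e \<subseteq> V \<and> card e = 2}"

definition nondegenerate :: "('v \<Rightarrow> real ^ 'd) \<Rightarrow> 'v set \<Rightarrow> bool" where
  "nondegenerate \<phi> e \<longleftrightarrow> (\<exists>u v. e = {u, v} \<and> \<phi> u \<noteq> \<phi> v)"

definition stretches ::
    "('v \<Rightarrow> real ^ 'd) \<Rightarrow> ('v \<Rightarrow> real ^ 'd) \<Rightarrow> 'v set \<Rightarrow> real \<Rightarrow> bool" where
  "stretches \<phi> \<psi> e l \<longleftrightarrow>
     0 \<le> l \<and> (\<forall>u v. e = {u, v} \<longrightarrow> \<psi> v - \<psi> u = l *\<^sub>R (\<phi> v - \<phi> u))"

definition deformation :: "'v set set \<Rightarrow> ('v \<Rightarrow> real ^ 'd) \<Rightarrow> ('v \<Rightarrow> real ^ 'd) \<Rightarrow> bool" where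
  "deformation E \<phi> \<psi> \<longleftrightarrow> (\<forall>e\<in>E. \<exists>l. stretches \<phi> \<psi> e l)"

text \<open>Only meaningful on non-degenerate pairs, where the coefficient is unique.\<close>

definition stretch_coeff :: "('v \<Rightarrow> real ^ 'd) \<Rightarrow> ('v \<Rightarrow> real ^ 'd) \<Rightarrow> 'v set \<Rightarrow> real" where
  "stretch_coeff \<phi> \<psi> e = (THE l. stretches \<phi> \<psi> e l)"

lemma stretch_coeff_eq:
  assumes "nondegenerate \<phi> e" "stretches \<phi> \<psi> e l"
  shows "stretch_coeff \<phi> \<psi> e = l"
  unfolding stretch_coeff_def
proof (rule the_equality)
  show "stretches \<phi> \<psi> e l" by (fact assms(2))
next
  fix m assume "stretches \<phi> \<psi> e m"
  then show "m = l"
    using assms by (auto simp: nondegenerate_def stretches_def)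
qed

text \<open>
  The space \<open>\<real>\<^sup>E\<close> is represented by the functions on sets of vertices that vanish outside \<open>E\<close>.
\<close>

definition edge_deformation_vector ::
    "'v set set \<Rightarrow> ('v \<Rightarrow> real ^ 'd) \<Rightarrow> ('v \<Rightarrow> real ^ 'd) \<Rightarrow> 'v set \<Rightarrow> real" where
  "edge_deformation_vector E \<phi> \<psi> =
     (\<lambda>e. if e \<in> E \<and> nondegenerate \<phi> e then stretch_coeff \<phi> \<psi> e else 0)"

definition deformation_cone :: "'v set set \<Rightarrow> ('v \<Rightarrow> real ^ 'd) \<Rightarrow> ('v set \<Rightarrow> real) set" where
  "deformation_cone E \<phi> = {edge_deformation_vector E \<phi> \<psi> | \<psi>. deformation E \<phi> \<psi>}"

text \<open>
  The cone contains the origin, so its affine hull is its linear span and \<open>dim\<close>, the dimension of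
  the span, is its dimension as a polyhedral cone. The span is finite-dimensional when \<open>E\<close> is finite.
\<close>

lemma zero_in_deformation_cone: "0 \<in> deformation_cone E \<phi>"
proof -
  have *: "stretches \<phi> (\<lambda>_. 0) e 0" for e
    by (simp add: stretches_def)
  then have "edge_deformation_vector E \<phi> (\<lambda>_. 0) = 0"
    by (auto simp: edge_deformation_vector_def fun_eq_iff intro!: stretch_coeff_eq)
  moreover have "deformation E \<phi> (\<lambda>_. 0)"
    using * by (auto simp: deformation_def)
  ultimately show ?thesis
    unfolding deformation_cone_def by force
qed

definition implicit_edge :: "'v set \<Rightarrow> 'v set set \<Rightarrow> ('v \<Rightarrow> real ^ 'd) \<Rightarrow> 'v set \<Rightarrow> bool" where
  "implicit_edge V E \<phi> e \<longleftrightarrow>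
     (\<exists>u\<in>V. \<exists>v\<in>V. e = {u, v}) \<and> (\<forall>\<psi>. deformation E \<phi> \<psi> \<longrightarrow> (\<exists>l. stretches \<phi> \<psi> e l))"

definition dependent_edges ::
    "'v set set \<Rightarrow> ('v \<Rightarrow> real ^ 'd) \<Rightarrow> 'v set \<Rightarrow> 'v set \<Rightarrow> bool" where
  "dependent_edges E \<phi> e f \<longleftrightarrow>
     (\<forall>\<psi>. deformation E \<phi> \<psi> \<longrightarrow> stretch_coeff \<phi> \<psi> e = stretch_coeff \<phi> \<psi> f)"

definition dependent_edge_set ::
    "'v set \<Rightarrow> 'v set set \<Rightarrow> ('v \<Rightarrow> real ^ 'd) \<Rightarrow> 'v set set \<Rightarrow> bool" where
  "dependent_edge_set V E \<phi> X \<longleftrightarrow>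
     (\<forall>e\<in>X. implicit_edge V E \<phi> e \<and> nondegenerate \<phi> e) \<and>
     (\<forall>e\<in>X. \<forall>f\<in>X. dependent_edges E \<phi> e f)"

definition flat :: "'v set \<Rightarrow> 'v set set \<Rightarrow> 'v set \<Rightarrow> bool" where
  "flat V E F \<longleftrightarrow>
     F \<subseteq> V \<and> (\<forall>u\<in>F. \<forall>v\<in>F. (u, v) \<in> {(x, y). x \<in> F \<and> y \<in> F \<and> {x, y} \<in> E}\<^sup>*)"

definition flat_dir :: "('v \<Rightarrow> real ^ 'd) \<Rightarrow> 'v set \<Rightarrow> (real ^ 'd) set" where
  "flat_dir \<phi> F = span {\<phi> u - \<phi> v | u v. u \<in> F \<and> v \<in> F}"

text \<open>
  An empty subcollection never pins: its intersection of directions is the whole space, which is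
  not \<open>{0}\<close> since the dimension is at least one.
\<close>

definition pins :: "('v \<Rightarrow> real ^ 'd) \<Rightarrow> 'v set set \<Rightarrow> 'v \<Rightarrow> bool" where
  "pins \<phi> C v \<longleftrightarrow> (\<exists>I\<subseteq>C. v \<in> \<Inter>I \<and> (\<Inter>F\<in>I. flat_dir \<phi> F) = {0})"

definition grounded :: "'v set \<Rightarrow> 'v set set \<Rightarrow> bool" where
  "grounded S C \<longleftrightarrow> (\<forall>F\<in>C. F \<inter> S \<noteq> {})"

primrec pin_seq ::
    "'v set \<Rightarrow> 'v set set \<Rightarrow> ('v \<Rightarrow> real ^ 'd) \<Rightarrow> 'v set \<Rightarrow> nat \<Rightarrow> 'v set" where
  "pin_seq V E \<phi> S 0 = S"
| "pin_seq V E \<phi> S (Suc i) = pin_seq V E \<phi> S i \<union>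
     {v \<in> V. \<exists>C. (\<forall>F\<in>C. flat V E F) \<and> grounded (pin_seq V E \<phi> S i) C \<and> pins \<phi> C v}"

definition pin_closure ::
    "'v set \<Rightarrow> 'v set set \<Rightarrow> ('v \<Rightarrow> real ^ 'd) \<Rightarrow> 'v set \<Rightarrow> 'v set" where
  "pin_closure V E \<phi> S = (\<Union>i. pin_seq V E \<phi> S i)"

text \<open>The union is the set at which the increasing sequence stabilizes.\<close>

lemma pin_seq_stabilizes:
  assumes "finite V" "S \<subseteq> V"
  shows "\<exists>n. \<forall>i\<ge>n. pin_seq V E \<phi> S i = pin_closure V E \<phi> S"
proof -
  let ?T = "pin_seq V E \<phi> S"
  have mono: "?T i \<subseteq> ?T j" if "i \<le> j" for i j
    using that by (induction rule: dec_induct) auto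
  have sub: "?T i \<subseteq> V" for i
    using assms(2) by (induction i) auto
  have fin: "finite (pin_closure V E \<phi> S)"
    unfolding pin_closure_def using sub assms(1) by (meson UN_least finite_subset)
  have "\<forall>x\<in>pin_closure V E \<phi> S. \<exists>i. x \<in> ?T i"
    by (auto simp: pin_closure_def)
  then obtain k where k: "\<And>x. x \<in> pin_closure V E \<phi> S \<Longrightarrow> x \<in> ?T (k x)"
    by metis
  define n where "n = Max (insert 0 (k ` pin_closure V E \<phi> S))"
  have "?T i = pin_closure V E \<phi> S" if "n \<le> i" for i
  proof
    show "?T i \<subseteq> pin_closure V E \<phi> S"
      by (auto simp: pin_closure_def)
    show "pin_closure V E \<phi> S \<subseteq> ?T i"
    proof
      fix x assume x: "x \<in> pin_closure V E \<phi> S"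
      then have "k x \<le> n"
        unfolding n_def using fin by (intro Max_ge) auto
      then show "x \<in> ?T i"
        using k[OF x] mono[of "k x" i] that by auto
    qed
  qed
  then show ?thesis by blast
qed

end

theory Submission
  imports Defs
begin

text \<open>
  On the linear span of all deformations, the stretch coefficient of a non-degenerate implicit edge
  is the restriction of a linear functional, and every linear relation between deformations
  persists. Record for each \<open>\<psi>\<close> in this span its common coefficient on each of the sets \<open>X\<^sub>i\<close>. If
  these \<open>r\<close> numbers vanish, then \<open>\<psi>\<close> is constant on \<open>S\<close>, and pinning propagates this constant to
  all of \<open>V\<close>, so that all edge coefficients of \<open>\<psi>\<close> vanish. Hence the edge coefficients factor
  linearly through \<open>\<real>\<^sup>r\<close>.
\<close>

section \<open>Coefficients of pairs as linear functionals\<close>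

text \<open>The pair is oriented arbitrarily; the value does not depend on the orientation.\<close>

definition edge_coeff :: "('v \<Rightarrow> real ^ 'd) \<Rightarrow> 'v set \<Rightarrow> ('v \<Rightarrow> real ^ 'd) \<Rightarrow> real" where
  "edge_coeff \<phi> e \<psi> =
     (let (u, v) = SOME (u, v). e = {u, v}
      in (\<psi> v - \<psi> u) \<bullet> (\<phi> v - \<phi> u) / ((\<phi> v - \<phi> u) \<bullet> (\<phi> v - \<phi> u)))"

lemma edge_coeff_doubleton:
  "edge_coeff \<phi> {u, v} \<psi> = (\<psi> v - \<psi> u) \<bullet> (\<phi> v - \<phi> u) / ((\<phi> v - \<phi> u) \<bullet> (\<phi> v - \<phi> u))"
proof -
  obtain a b where ab: "(SOME (a, b). {u, v} = {a, b}) = (a, b)"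
    by fastforce
  have "case SOME (a, b). {u, v} = {a, b} of (a, b) \<Rightarrow> {u, v} = {a, b}"
    by (rule someI[of _ "(u, v)"]) simp
  with ab have "{u, v} = {a, b}"
    by simp
  then consider "a = u" "b = v" | "a = v" "b = u"
    by (auto simp: doubleton_eq_iff)
  then show ?thesis
  proof cases
    case 1
    then show ?thesis by (simp add: edge_coeff_def ab)
  next
    case 2
    \<comment> \<open>Reversing the orientation negates both differences, and the two signs cancel
      in each inner product.\<close>
    have "(\<psi> u - \<psi> v) \<bullet> (\<phi> u - \<phi> v) = (\<psi> v - \<psi> u) \<bullet> (\<phi> v - \<phi> u)"
      and "(\<phi> u - \<phi> v) \<bullet> (\<phi> u - \<phi> v) = (\<phi> v - \<phi> u) \<bullet> (\<phi> v - \<phi> u)"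
      by (metis inner_minus_left inner_minus_right minus_diff_eq)+
    with 2 show ?thesis by (simp add: edge_coeff_def ab)
  qed
qed

text \<open>The orientation chosen by \<open>SOME\<close> depends on \<open>e\<close> alone, so one
  quotient with a fixed denominator serves all \<open>\<psi>\<close>. On a degenerate pair, division
  by zero makes it the zero functional.\<close>

lemma linear_edge_coeff: "linear (edge_coeff \<phi> e)"
proof -
  obtain u v where "(SOME (u, v). e = {u, v}) = (u, v)"
    by fastforce
  then show ?thesis
    by (intro linearI)
       (simp_all add: edge_coeff_def plus_fun_def scaleR_fun_def inner_add_left inner_diff_left
         add_divide_distrib diff_divide_distrib right_diff_distrib)
qed

lemma edge_coeff_stretches:
  assumes "nondegenerate \<phi> e" "stretches \<phi> \<psi> e l"
  shows "edge_coeff \<phi> e \<psi> = l"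
proof -
  obtain u v where "e = {u, v}" "\<phi> u \<noteq> \<phi> v"
    using assms(1) by (auto simp: nondegenerate_def)
  moreover from this have "\<psi> v - \<psi> u = l *\<^sub>R (\<phi> v - \<phi> u)"
    using assms(2) by (simp add: stretches_def)
  ultimately show ?thesis
    by (simp add: edge_coeff_doubleton)
qed

lemma stretch_coeff_eq_edge_coeff:
  assumes "nondegenerate \<phi> e" "stretches \<phi> \<psi> e l"
  shows "stretch_coeff \<phi> \<psi> e = edge_coeff \<phi> e \<psi>"
  using stretch_coeff_eq[OF assms] edge_coeff_stretches[OF assms] by simp

section \<open>Relations that pass from deformations to their span\<close>

lemma linear_apply_diff: "linear (\<lambda>\<psi>::'v \<Rightarrow> 'b::real_vector. \<psi> v - \<psi> u)"
  by (intro linearI) (simp_all add: plus_fun_def scaleR_fun_def algebra_simps)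

text \<open>The sign condition on the coefficient is lost in the span, but the vector equation
  survives: both sides are linear in \<open>\<psi>\<close> and agree on every deformation.\<close>

lemma implicit_edge_coeff_span:
  assumes "\<psi> \<in> span {\<psi>. deformation E \<phi> \<psi>}" "implicit_edge V E \<phi> {u, v}"
    and "nondegenerate \<phi> {u, v}"
  shows "\<psi> v - \<psi> u = edge_coeff \<phi> {u, v} \<psi> *\<^sub>R (\<phi> v - \<phi> u)"
proof (rule linear_eq_on[OF linear_apply_diff _ assms(1)])
  show "linear (\<lambda>\<psi>. edge_coeff \<phi> {u, v} \<psi> *\<^sub>R (\<phi> v - \<phi> u))"
    by (intro linearI)
       (simp_all add: linear_add[OF linear_edge_coeff] linear_scale[OF linear_edge_coeff]
         scaleR_left_distrib)
next
  fix \<psi> assume "\<psi> \<in> {\<psi>. deformation E \<phi> \<psi>}"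
  then obtain l where l: "stretches \<phi> \<psi> {u, v} l"
    using assms(2) by (auto simp: implicit_edge_def)
  with edge_coeff_stretches[OF assms(3) l]
  show "\<psi> v - \<psi> u = edge_coeff \<phi> {u, v} \<psi> *\<^sub>R (\<phi> v - \<phi> u)"
    by (auto simp: stretches_def)
qed

lemma dependent_edge_coeff_span:
  assumes "\<psi> \<in> span {\<psi>. deformation E \<phi> \<psi>}" "dependent_edge_set V E \<phi> X" "e \<in> X" "f \<in> X"
  shows "edge_coeff \<phi> e \<psi> = edge_coeff \<phi> f \<psi>"
proof (rule linear_eq_on[OF linear_edge_coeff linear_edge_coeff assms(1)])
  fix \<psi> assume \<psi>: "\<psi> \<in> {\<psi>. deformation E \<phi> \<psi>}"
  have "stretch_coeff \<phi> \<psi> g = edge_coeff \<phi> g \<psi>" if "g \<in> X" for g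
  proof -
    have "implicit_edge V E \<phi> g" "nondegenerate \<phi> g"
      using that assms(2) by (auto simp: dependent_edge_set_def)
    moreover from this \<psi> obtain l where "stretches \<phi> \<psi> g l"
      by (auto simp: implicit_edge_def)
    ultimately show ?thesis
      by (simp add: stretch_coeff_eq_edge_coeff)
  qed
  moreover have "stretch_coeff \<phi> \<psi> e = stretch_coeff \<phi> \<psi> f"
    using \<psi> assms(2-4) unfolding dependent_edge_set_def dependent_edges_def by blast
  ultimately show "edge_coeff \<phi> e \<psi> = edge_coeff \<phi> f \<psi>"
    using assms(3,4) by simp
qed

text \<open>Membership in a line replaces an explicit coefficient, so that degenerate edges are
  covered too: there the span is \<open>{0}\<close>.\<close>

lemma edge_diff_in_span:
  assumes "\<psi> \<in> span {\<psi>. deformation E \<phi> \<psi>}" "{u, v} \<in> E"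
  shows "\<psi> v - \<psi> u \<in> span {\<phi> v - \<phi> u}"
  using assms(1)
proof (induction rule: span_induct)
  from linear_subspace_vimage[OF linear_apply_diff subspace_span]
  show "subspace {\<psi>. \<psi> v - \<psi> u \<in> span {\<phi> v - \<phi> u}}"
    by (simp add: vimage_def)
next
  fix \<psi> assume "\<psi> \<in> {\<psi>. deformation E \<phi> \<psi>}"
  then obtain l where "stretches \<phi> \<psi> {u, v} l"
    using assms(2) by (auto simp: deformation_def)
  then have "\<psi> v - \<psi> u = l *\<^sub>R (\<phi> v - \<phi> u)"
    by (auto simp: stretches_def)
  then show "\<psi> v - \<psi> u \<in> span {\<phi> v - \<phi> u}"
    by (simp add: span_base span_scale)
qed

section \<open>Flats, pinning and constancy\<close>

text \<open>The difference telescopes along a path of edges inside \<open>F\<close>, and each edge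
  contributes a multiple of a generator of \<open>flat_dir \<phi> F\<close>.\<close>

lemma flat_diff_in_flat_dir:
  assumes "\<psi> \<in> span {\<psi>. deformation E \<phi> \<psi>}" "flat V E F" "u \<in> F" "v \<in> F"
  shows "\<psi> v - \<psi> u \<in> flat_dir \<phi> F"
proof -
  have "(u, v) \<in> {(x, y). x \<in> F \<and> y \<in> F \<and> {x, y} \<in> E}\<^sup>*"
    using assms by (auto simp: flat_def)
  then show ?thesis
  proof (induction rule: rtrancl_induct)
    case base
    show ?case by (simp add: flat_dir_def span_zero)
  next
    case (step y z)
    then have "\<phi> z - \<phi> y \<in> flat_dir \<phi> F"
      by (auto simp: flat_dir_def intro: span_base)
    then have "span {\<phi> z - \<phi> y} \<subseteq> flat_dir \<phi> F"
      by (simp add: flat_dir_def span_minimal)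
    moreover have "\<psi> z - \<psi> y \<in> span {\<phi> z - \<phi> y}"
      using step by (intro edge_diff_in_span[OF assms(1)]) auto
    ultimately have "(\<psi> z - \<psi> y) + (\<psi> y - \<psi> u) \<in> flat_dir \<phi> F"
      using step.IH unfolding flat_dir_def by (blast intro: span_add)
    then show ?case by simp
  qed
qed

lemma constant_on_pin_closure:
  assumes "\<psi> \<in> span {\<psi>. deformation E \<phi> \<psi>}" "\<And>v. v \<in> S \<Longrightarrow> \<psi> v = c"
    and "v \<in> pin_closure V E \<phi> S"
  shows "\<psi> v = c"
proof -
  have "\<forall>v\<in>pin_seq V E \<phi> S i. \<psi> v = c" for i
  proof (induction i)
    case 0
    show ?case using assms(2) by simp
  next
    case (Suc i)
    have "\<psi> v = c" if C: "\<forall>F\<in>C. flat V E F" "grounded (pin_seq V E \<phi> S i) C" "pins \<phi> C v"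
      for C v
    proof -
      obtain I where I: "I \<subseteq> C" "v \<in> \<Inter>I" "(\<Inter>F\<in>I. flat_dir \<phi> F) = {0}"
        using C(3) by (auto simp: pins_def)
      have "\<psi> v - c \<in> flat_dir \<phi> F" if "F \<in> I" for F
      proof -
        \<comment> \<open>Groundedness gives a vertex \<open>w\<close> of \<open>F\<close> where
          \<open>\<psi>\<close> is already known to be \<open>c\<close>, so
          \<open>\<psi> v - c\<close> is a difference between two vertices of
          \<open>F\<close>.\<close>
        obtain w where "w \<in> F" "w \<in> pin_seq V E \<phi> S i"
          using \<open>F \<in> I\<close> I(1) C(2) by (auto simp: grounded_def)
        with flat_diff_in_flat_dir[OF assms(1), of V F w v] Suc.IH C(1) I that
        show ?thesis by auto
      qed
      then have "\<psi> v - c \<in> (\<Inter>F\<in>I. flat_dir \<phi> F)" by blast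
      with I(3) show ?thesis by simp
    qed
    with Suc.IH show ?case by auto
  qed
  with assms(3) show ?thesis by (auto simp: pin_closure_def)
qed

lemma constant_along_path:
  assumes "(u, v) \<in> R\<^sup>*" "\<And>x y. (x, y) \<in> R \<Longrightarrow> f x = f y"
  shows "f u = f v"
  using assms(1)
proof (induction rule: rtrancl_induct)
  case (step y z)
  from step.IH assms(2)[OF step.hyps(2)] show ?case by (rule trans)
qed (rule refl)

section \<open>Comparing dimensions of linear images\<close>

lemma linear_fun:
  fixes f :: "'a::real_vector \<Rightarrow> 'i \<Rightarrow> 'b::real_vector"
  assumes "\<And>i. linear (\<lambda>x. f x i)"
  shows "linear f"
proof (rule linearI)
  show "f (x + y) = f x + f y" for x y
    by (rule ext) (simp add: linear_add[OF assms])
  show "f (c *\<^sub>R x) = c *\<^sub>R f x" for c x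
    by (rule ext) (simp add: linear_scale[OF assms] scaleR_fun_def)
qed

lemma dim_linear_image_le:
  fixes L :: "'a::real_vector \<Rightarrow> 'b::real_vector" and M :: "'a \<Rightarrow> 'c::real_vector"
  assumes L: "linear L" and M: "linear M"
    and ker: "\<And>x. x \<in> span A \<Longrightarrow> M x = 0 \<Longrightarrow> L x = 0"
    and W: "finite W" "M ` A \<subseteq> span W"
  shows "dim (L ` A) \<le> card W"
proof -
  obtain B where B: "B \<subseteq> M ` A" "independent B" "M ` A \<subseteq> span B"
    using maximal_independent_subset[of "M ` A"] by blast
  have fin: "finite B" and card: "card B \<le> card W"
    using independent_span_bound[of W B] B W by auto
  obtain C where C: "C \<subseteq> A" "B = M ` C" "inj_on M C"
    using B(1) by (metis subset_image_inj)
  have "L ` A \<subseteq> span (L ` C)"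
  proof
    fix y assume "y \<in> L ` A"
    then obtain a where a: "a \<in> A" "y = L a" by blast
    have "M a \<in> M ` span C"
      using a B(3) C(2) M by (metis imageI linear_span_image subsetD)
    then obtain b where b: "b \<in> span C" "M a = M b" by blast
    have "b \<in> span A"
      using b(1) C(1) span_mono by blast
    \<comment> \<open>The vector \<open>a - b\<close> lies in \<open>span A\<close> but perhaps not
      in \<open>A\<close>, which is why \<open>ker\<close> is assumed on the whole span.\<close>
    then have "L (a - b) = 0"
      using a(1) b(2) M by (intro ker) (auto simp: linear_diff span_base span_diff)
    then have "y = L b"
      using a(2) L by (simp add: linear_diff)
    then show "y \<in> span (L ` C)"
      using b(1) L by (simp add: linear_span_image)
  qed
  moreover have "finite C"
    using C fin finite_image_iff by blast
  ultimately have "dim (L ` A) \<le> card (L ` C)"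
    by (intro dim_le_card) auto
  also have "\<dots> \<le> card C"
    by (rule card_image_le) fact
  also have "\<dots> = card B"
    using C by (simp add: card_image)
  finally show ?thesis using card by linarith
qed

section \<open>The bound on the dimension of the deformation cone\<close>

theorem theorem2p6p13:
  fixes V :: "'v set" and E :: "'v set set" and \<phi> :: "'v \<Rightarrow> real ^ 'd"
    and X :: "nat \<Rightarrow> 'v set set" and r :: nat and S :: "'v set"
  assumes "framework V E \<phi>"
    and "\<And>i. i \<in> {1..r} \<Longrightarrow> dependent_edge_set V E \<phi> (X i)"
    and "S \<subseteq> V"
    and "\<And>u v. u \<in> S \<Longrightarrow> v \<in> S \<Longrightarrow> (u, v) \<in> {(x, y). {x, y} \<in> (\<Union>i\<in>{1..r}. X i)}\<^sup>*"
    and "pin_closure V E \<phi> S = V"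
  shows "dim (deformation_cone E \<phi>) \<le> r"
proof -
  let ?D = "{\<psi>. deformation E \<phi> \<psi>}"
  define L where
    "L = (\<lambda>\<psi> e. if e \<in> E \<and> nondegenerate \<phi> e then edge_coeff \<phi> e \<psi> else 0)"
  \<comment> \<open>One representative per set suffices by dependence. If \<open>X i\<close> is
    empty, \<open>x i\<close> is arbitrary, but \<open>M\<close> remains linear and
    \<open>x i\<close> is compared only with actual members of \<open>X i\<close>.\<close>
  define x where "x = (\<lambda>i. SOME e. e \<in> X i)"
  \<comment> \<open>\<open>M\<close> takes values in a copy of \<open>\<real>^r\<close>: the
    functions vanishing off \<open>{1..r}\<close>, with the unit vectors \<open>b i\<close> as
    basis.\<close>
  define M where "M = (\<lambda>\<psi> i. if i \<in> {1..r} then edge_coeff \<phi> (x i) \<psi> else 0)"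
  define b where "b = (\<lambda>(i::nat) j. if j = i then 1 else 0 :: real)"
  have L: "linear L"
    unfolding L_def
  proof (rule linear_fun)
    show "linear (\<lambda>\<psi>. if C then edge_coeff \<phi> e \<psi> else 0)" for C e
      by (cases C) (simp_all add: linear_edge_coeff linear_zero)
  qed
  have M: "linear M"
    unfolding M_def
  proof (rule linear_fun)
    show "linear (\<lambda>\<psi>. if C then edge_coeff \<phi> e \<psi> else 0)" for C e
      by (cases C) (simp_all add: linear_edge_coeff linear_zero)
  qed
  have cone: "deformation_cone E \<phi> = L ` ?D"
  proof -
    have "edge_deformation_vector E \<phi> \<psi> = L \<psi>" if "deformation E \<phi> \<psi>" for \<psi>
      using that stretch_coeff_eq_edge_coeff
      by (fastforce simp: edge_deformation_vector_def L_def deformation_def)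
    then show ?thesis
      unfolding deformation_cone_def by auto metis
  qed
  have "L \<psi> = 0" if \<psi>: "\<psi> \<in> span ?D" and "M \<psi> = 0" for \<psi>
  proof -
    have X: "\<psi> u = \<psi> v" if uv: "{u, v} \<in> (\<Union>i\<in>{1..r}. X i)" for u v
    proof -
      obtain i where i: "i \<in> {1..r}" "{u, v} \<in> X i"
        using uv by blast
      then have "x i \<in> X i"
        unfolding x_def by (metis someI)
      then have "edge_coeff \<phi> {u, v} \<psi> = edge_coeff \<phi> (x i) \<psi>"
        using dependent_edge_coeff_span[OF \<psi> assms(2)] i by blast
      also have "\<dots> = M \<psi> i"
        using i(1) by (simp add: M_def)
      also have "\<dots> = 0"
        using \<open>M \<psi> = 0\<close> by simp
      finally show ?thesis
        using implicit_edge_coeff_span[OF \<psi>, of V u v] assms(2)[OF i(1)] i(2)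
        by (simp add: dependent_edge_set_def)
    qed
    have "\<psi> u = \<psi> v" if "u \<in> S" "v \<in> S" for u v
      using constant_along_path[OF assms(4)[OF that], of \<psi>] X by blast
    \<comment> \<open>For empty \<open>S\<close> any \<open>c\<close> will do.\<close>
    then obtain c where "\<And>v. v \<in> S \<Longrightarrow> \<psi> v = c"
      by metis
    then have c: "\<psi> v = c" if "v \<in> V" for v
      using constant_on_pin_closure[OF \<psi>, of S c v V] that assms(5) by blast
    show "L \<psi> = 0"
    proof
      fix e
      have "edge_coeff \<phi> e \<psi> = 0" if "e \<in> E"
      proof -
        have "e \<subseteq> V" "card e = 2"
          using that assms(1) by (auto simp: framework_def)
        then obtain u v where "e = {u, v}" "u \<in> V" "v \<in> V"
          by (metis card_2_iff insert_subset)
        then show ?thesis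
          using c by (simp add: edge_coeff_doubleton)
      qed
      then show "L \<psi> e = 0 e"
        by (simp add: L_def)
    qed
  qed
  moreover have "M ` ?D \<subseteq> span (b ` {1..r})"
  proof clarify
    fix \<psi>
    have sum_apply: "(\<Sum>i\<in>I. f i) j = (\<Sum>i\<in>I. f i j)" if "finite I"
      for f :: "nat \<Rightarrow> nat \<Rightarrow> real" and I j
      using that by induction auto
    \<comment> \<open>Outside \<open>{1..r}\<close> both sides are zero, by the default value in
      \<open>M\<close>.\<close>
    have "M \<psi> = (\<Sum>i\<in>{1..r}. M \<psi> i *\<^sub>R b i)"
      by (auto simp: fun_eq_iff sum_apply scaleR_fun_def b_def M_def if_distrib cong: if_cong)
    also have "\<dots> \<in> span (b ` {1..r})"
      by (intro span_sum span_scale span_base) auto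
    finally show "M \<psi> \<in> span (b ` {1..r})" .
  qed
  ultimately have "dim (L ` ?D) \<le> card (b ` {1..r})"
    using L M by (intro dim_linear_image_le) auto
  also have "\<dots> \<le> card {1..r}"
    by (rule card_image_le) simp
  finally show ?thesis
    by (simp add: cone)
qed

end
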